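(* Let $\mathcal{X}\subset\mathbb{R}^n$ be an input set, and let $\mathcal{Y}=\{\mathrm{ReLU}(\mathbf{x})\mid \mathbf{x}\in\mathcal{X}\}$ be the output reachable set of the function $\mathbf{y}=\mathrm{ReLU}(\mathbf{x})$ with input set $\mathcal{X}$. Then $$\mathcal{Y}=\mathcal{Y}^{+}\cup\mathcal{Y}^{-}\cup\left(\bigcup_{h=1}^{2^n-2}\mathcal{Y}_h\right),$$ where $$\mathcal{Y}^{+}=\{\mathbf{y}\mid \mathbf{y}=\mathbf{x},\ \mathbf{x}\in\mathcal{X}^{+}\},\qquad \mathcal{X}^{+}=\{\mathbf{x}\mid \mathbf{x}>\mathbf{0},\ \mathbf{x}\in\mathcal{X}\},$$ $$\mathcal{Y}^{-}=\{\mathbf{y}\mid \mathbf{y}=\mathbf{0},\ \mathbf{x}\in\mathcal{X}^{-}\},\qquad \mathcal{X}^{-}=\{\mathbf{x}\mid \mathbf{x}\le\mathbf{0},\ \mathbf{x}\in\mathcal{X}\}$$ (so $\mathcal{Y}^-=\{\mathbf{0}\}$ if $\mathcal{X}^-\neq\emptyset$ and $\mathcal{Y}^-=\emptyset$ otherwise), and for $h=1,\ldots,2^n-2$, $$\mathcal{Y}_h=\{\mathbf{y}\mid \mathbf{y}=\mathbf{x},\ \mathbf{x}\in\mathcal{X}_h^{+}\},\qquad \mathcal{X}_h^{+}=\{\mathbf{x}\mid \mathbf{P}_h\mathbf{x}\ge\mathbf{0},\ \mathbf{x}\in\mathcal{X}_h^{-}\},\qquad \mathcal{X}_h^{-}=\{\mathbf{x}\mid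 (\mathbf{I}-\mathbf{P}_h)\mathbf{x}\le\mathbf{0},\ \mathbf{x}\in\mathcal{X}\}.$$
   Context: For a real number $x$, $\mathrm{ReLU}(x)=0$ if $x\le 0$ and $\mathrm{ReLU}(x)=x$ if $x>0$; on $\mathbb{R}^n$, $\mathrm{ReLU}$ is applied element-wise. No restriction is imposed on the input set $\mathcal{X}$. Vector inequalities ($>,\ge,\le$) are element-wise, and $\mathbf{I}$ is the $n\times n$ identity matrix. Let $\mathbf{p}_0,\mathbf{p}_1,\ldots,\mathbf{p}_{2^n-1}$ be the enumeration of all vectors in $\{0,1\}^n$ in which $\mathbf{p}_h$ is the $n$-digit binary expansion of $h$; thus $\mathbf{p}_0=[0,\ldots,0]$ and $\mathbf{p}_{2^n-1}=[1,\ldots,1]$, and the vectors $\mathbf{p}_h$ with $1\le h\le 2^n-2$ are exactly those having both a $0$ and a $1$ entry. Set $\mathbf{P}_h=\mathrm{diag}(\mathbf{p}_h)$, the $n\times n$ diagonal matrix with diagonal $\mathbf{p}_h$.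
   Formalization: The set Y_h is taken with y = P_h x instead of y = x; as literally written the identity fails, e.g. for n = 2 and X = {(1,-1)}, where Y = {(1,0)} but the right-hand side is {(1,-1)}. *)

theory Defs
  imports Complex_Main "Jordan_Normal_Form.Matrix"
begin

text \<open>
  Vectors of dimension n are the elements of \<^term>\<open>carrier_vec n\<close>, with entries numbered
  from 0 to n - 1.  The order \<open>\<le>\<close> on vectors is element-wise, but \<open><\<close> on vectors is its strict
  part, which is not element-wise strict inequality.
\<close>

definition relu :: "real \<Rightarrow> real" where
  "relu x = (if x \<le> 0 then 0 else x)"

definition relu_vec :: "real vec \<Rightarrow> real vec" where
  "relu_vec = map_vec relu"

definition vec_all_less :: "real vec \<Rightarrow> real vec \<Rightarrow> bool" where
  "vec_all_less v w \<longleftrightarrow> dim_vec v = dim_vec w \<and> (\<forall>i<dim_vec w. v $ i < w $ i)"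

text \<open>The n-digit binary expansion of h, most significant digit first.\<close>

definition p_vec :: "nat \<Rightarrow> nat \<Rightarrow> real vec" where
  "p_vec n h = vec n (\<lambda>i. of_bool (bit h (n - 1 - i)))"

definition P_mat :: "nat \<Rightarrow> nat \<Rightarrow> real mat" where
  "P_mat n h = mat_diag n (\<lambda>i. p_vec n h $ i)"

definition Y_reach :: "real vec set \<Rightarrow> real vec set" where
  "Y_reach X = {relu_vec x | x. x \<in> X}"

definition X_pos :: "nat \<Rightarrow> real vec set \<Rightarrow> real vec set" where
  "X_pos n X = {x. vec_all_less (0\<^sub>v n) x \<and> x \<in> X}"

definition Y_pos :: "nat \<Rightarrow> real vec set \<Rightarrow> real vec set" where
  "Y_pos n X = {y. \<exists>x \<in> X_pos n X. y = x}"

definition X_neg :: "nat \<Rightarrow> real vec set \<Rightarrow> real vec set" where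
  "X_neg n X = {x. x \<le> 0\<^sub>v n \<and> x \<in> X}"

definition Y_neg :: "nat \<Rightarrow> real vec set \<Rightarrow> real vec set" where
  "Y_neg n X = {y. \<exists>x \<in> X_neg n X. y = 0\<^sub>v n}"

definition X_h_neg :: "nat \<Rightarrow> nat \<Rightarrow> real vec set \<Rightarrow> real vec set" where
  "X_h_neg n h X = {x. (1\<^sub>m n - P_mat n h) *\<^sub>v x \<le> 0\<^sub>v n \<and> x \<in> X}"

definition X_h_pos :: "nat \<Rightarrow> nat \<Rightarrow> real vec set \<Rightarrow> real vec set" where
  "X_h_pos n h X = {x. P_mat n h *\<^sub>v x \<ge> 0\<^sub>v n \<and> x \<in> X_h_neg n h X}"

text \<open>
  The source states the definition of this set with y = x in place of y = P x, where P is the matrix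
  \<^term>\<open>P_mat n h\<close>.  Taken literally it makes the decomposition false: for n = 2 and the input set
  with the single element (1, -1), the reachable set is {(1, 0)}, whereas the sets with y = x have
  union {(1, -1)}.  The entries of x selected by I - P are nonpositive, so ReLU sends them to 0;
  multiplication by P does exactly this.
\<close>

definition Y_h :: "nat \<Rightarrow> nat \<Rightarrow> real vec set \<Rightarrow> real vec set" where
  "Y_h n h X = {y. \<exists>x \<in> X_h_pos n h X. y = P_mat n h *\<^sub>v x}"

end

theory Submission
  imports Defs
begin

text \<open>
  The index h of the piece containing a given x records the sign pattern of x: its binary digits mark
  the positive entries.  The all-ones and all-zeros patterns are the two sets with superscript
  + and -, and every other pattern is one of the mixed indices.
\<close>

text \<open>Supplies the index for a prescribed sign pattern: the witness is the number whose binary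
  digits, least significant first, are \<open>f 0\<close>, ..., \<open>f (n - 1)\<close>.\<close>

lemma ex_nat_bits: "\<exists>h<2 ^ n. \<forall>j<n. bit (h::nat) j \<longleftrightarrow> f j"
proof (intro exI conjI)
  let ?h = "horner_sum of_bool 2 (map f [0..<n]) :: nat"
  \<comment> \<open>The Horner sum has no bits at positions n and above, so truncation to n bits
    fixes it; this gives the bound.\<close>
  have "take_bit n ?h = ?h"
    by (rule bit_eqI) (auto simp: bit_take_bit_iff bit_horner_sum_bit_iff)
  then show "?h < 2 ^ n"
    by (metis take_bit_nat_less_exp)
  show "\<forall>j<n. bit ?h j \<longleftrightarrow> f j"
    by (simp add: bit_horner_sum_bit_iff)
qed

lemma P_mat_mult_vec:
  assumes "x \<in> carrier_vec n"
  shows "P_mat n h *\<^sub>v x = vec n (\<lambda>i. if bit h (n - 1 - i) then x $ i else 0)"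
proof (rule eq_vecI)
  fix i assume "i < dim_vec (vec n (\<lambda>i. if bit h (n - 1 - i) then x $ i else 0))"
  then have i: "i < n" by simp
  have "(P_mat n h *\<^sub>v x) $ i = (\<Sum>j\<in>{0..<n}. (if i = j then p_vec n h $ j else 0) * x $ j)"
    using i assms by (simp add: P_mat_def mat_diag_def scalar_prod_def)
  also have "\<dots> = (\<Sum>j\<in>{0..<n}. if j = i then p_vec n h $ i * x $ i else 0)"
    by (rule sum.cong) auto
  also have "\<dots> = (if bit h (n - 1 - i) then x $ i else 0)"
    using i by (simp add: p_vec_def)
  finally show "(P_mat n h *\<^sub>v x) $ i = vec n (\<lambda>i. if bit h (n - 1 - i) then x $ i else 0) $ i"
    using i by simp
qed (simp add: P_mat_def mat_diag_def)

lemma one_minus_P_mat_mult_vec: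
  assumes "x \<in> carrier_vec n"
  shows "(1\<^sub>m n - P_mat n h) *\<^sub>v x = vec n (\<lambda>i. if bit h (n - 1 - i) then 0 else x $ i)"
proof -
  have "P_mat n h \<in> carrier_mat n n"
    by (simp add: P_mat_def mat_diag_def)
  then have "(1\<^sub>m n - P_mat n h) *\<^sub>v x = x - P_mat n h *\<^sub>v x"
    using assms minus_mult_distrib_mat_vec[OF one_carrier_mat, of "P_mat n h" n x]
    by (metis one_mult_mat_vec)
  then show ?thesis
    using assms by (auto simp: P_mat_mult_vec)
qed

text \<open>Each matrix keeps some entries and zeroes the rest, and a zeroed row only contributes
  the trivial condition \<open>0 \<le> 0\<close>. A zero entry of x satisfies either sign condition,
  so pieces for different h may overlap.\<close>

lemma X_h_pos_iff:
  assumes "x \<in> carrier_vec n"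
  shows "x \<in> X_h_pos n h X \<longleftrightarrow>
    x \<in> X \<and> (\<forall>i<n. if bit h (n - 1 - i) then 0 \<le> x $ i else x $ i \<le> 0)"
  unfolding X_h_pos_def X_h_neg_def mem_Collect_eq
    P_mat_mult_vec[OF assms] one_minus_P_mat_mult_vec[OF assms]
  by (auto simp: less_eq_vec_def)

text \<open>On entries selected by P, x is nonnegative and ReLU is the identity; on the others x is
  nonpositive and both sides are 0.\<close>

lemma relu_vec_eq_P_mat_mult_vec:
  assumes "x \<in> carrier_vec n" "x \<in> X_h_pos n h X"
  shows "relu_vec x = P_mat n h *\<^sub>v x"
  using assms
  by (auto simp: X_h_pos_iff P_mat_mult_vec relu_vec_def relu_def intro!: eq_vecI split: if_splits)

lemma relu_vec_pos: "vec_all_less (0\<^sub>v n) x \<Longrightarrow> relu_vec x = x"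
  by (auto simp: vec_all_less_def relu_vec_def relu_def intro!: eq_vecI)

lemma relu_vec_nonpos: "x \<le> 0\<^sub>v n \<Longrightarrow> relu_vec x = 0\<^sub>v n"
  by (auto simp: less_eq_vec_def relu_vec_def relu_def intro!: eq_vecI)

lemma sign_cases:
  assumes x: "x \<in> X" "x \<in> carrier_vec n"
  obtains "x \<in> X_pos n X" | "x \<in> X_neg n X" | h where "h \<in> {1..2 ^ n - 2}" "x \<in> X_h_pos n h X"
proof (cases "(\<forall>i<n. 0 < x $ i) \<or> (\<forall>i<n. x $ i \<le> 0)")
  case True
  then have "x \<in> X_pos n X \<or> x \<in> X_neg n X"
    using x by (auto simp: X_pos_def X_neg_def vec_all_less_def less_eq_vec_def)
  then show thesis
    using that(1,2) by blast
next
  case False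
  \<comment> \<open>The positive entry b will exclude h = 0, and the nonpositive entry a will
    exclude h = 2^n - 1.\<close>
  then obtain a b where ab: "a < n" "x $ a \<le> 0" "b < n" "0 < x $ b"
    by (auto simp: not_less not_le)
  \<comment> \<open>The reversal of positions matches \<open>p_vec\<close>, which lists the most
    significant digit first; it is its own inverse on indices below n.\<close>
  obtain h :: nat where h: "h < 2 ^ n" "\<forall>j<n. bit h j \<longleftrightarrow> 0 < x $ (n - 1 - j)"
    using ex_nat_bits[of n "\<lambda>j. 0 < x $ (n - 1 - j)"] by blast
  have bit: "bit h (n - 1 - i) \<longleftrightarrow> 0 < x $ i" if "i < n" for i
    using h(2)[rule_format, of "n - 1 - i"] that by simp
  have "h \<noteq> 0"
    using bit[OF ab(3)] ab(4) by (metis bit_0_eq bot_apply bot_bool_def)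
  moreover have "h \<noteq> 2 ^ n - 1"
  proof
    assume "h = 2 ^ n - 1"
    \<comment> \<open>All n low bits of the mask are set, but the bit belonging to entry a is
      clear.\<close>
    then have "h = mask n" by (simp add: mask_eq_exp_minus_1)
    then show False
      using bit[OF ab(1)] ab(1,2) by (simp add: bit_mask_iff)
  qed
  ultimately have "h \<in> {1..2 ^ n - 2}"
    using h(1) by auto
  moreover have "x \<in> X_h_pos n h X"
    \<comment> \<open>Zero entries of x receive digit 0 and so fall under the condition
      \<open>x $ i \<le> 0\<close>.\<close>
    using x bit by (auto simp: X_h_pos_iff)
  ultimately show thesis
    by (rule that(3))
qed

theorem theorem1:
  fixes n :: nat and X :: "real vec set"
  assumes "X \<subseteq> carrier_vec n"
  shows "Y_reach X = Y_pos n X \<union> Y_neg n X \<union> (\<Union>h\<in>{1..2 ^ n - 2}. Y_h n h X)"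
    (is "_ = ?R")
proof
  show "Y_reach X \<subseteq> ?R"
  proof
    fix y assume "y \<in> Y_reach X"
    then obtain x where x: "x \<in> X" "y = relu_vec x"
      by (auto simp: Y_reach_def)
    then have xc: "x \<in> carrier_vec n" using assms by blast
    from x(1) xc show "y \<in> ?R"
    proof (cases rule: sign_cases)
      case 1
      then have "y \<in> Y_pos n X"
        using x(2) relu_vec_pos by (auto simp: X_pos_def Y_pos_def)
      then show ?thesis by blast
    next
      case 2
      then have "y \<in> Y_neg n X"
        using x(2) relu_vec_nonpos by (auto simp: X_neg_def Y_neg_def)
      then show ?thesis by blast
    next
      case (3 h)
      then have "y \<in> Y_h n h X"
        using x(2) relu_vec_eq_P_mat_mult_vec[OF xc] by (auto simp: Y_h_def)
      then show ?thesis using 3(1) by blast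
    qed
  qed
next
  \<comment> \<open>Conversely, on each piece the map used there (the identity, the zero map,
    multiplication by P) agrees with ReLU, so every listed y is the ReLU image of the same
    x.\<close>
  have "Y_pos n X \<subseteq> Y_reach X"
    using relu_vec_pos by (force simp: Y_pos_def X_pos_def Y_reach_def)
  moreover have "Y_neg n X \<subseteq> Y_reach X"
    using relu_vec_nonpos by (force simp: Y_neg_def X_neg_def Y_reach_def)
  moreover have "Y_h n h X \<subseteq> Y_reach X" for h
  proof
    fix y assume "y \<in> Y_h n h X"
    then obtain x where x: "x \<in> X_h_pos n h X" "y = P_mat n h *\<^sub>v x"
      by (auto simp: Y_h_def)
    then have "x \<in> X" by (simp add: X_h_pos_def X_h_neg_def)
    moreover have "y = relu_vec x"
      using x calculation assms by (auto intro: relu_vec_eq_P_mat_mult_vec[symmetric])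
    ultimately show "y \<in> Y_reach X"
      by (auto simp: Y_reach_def)
  qed
  ultimately show "?R \<subseteq> Y_reach X" by blast
qed

end
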